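(* Let $G$ be a graph with two distinct distinguished vertices $g_+, g_-$, and let $H$ be a graph with two distinct distinguished vertices $h_+, h_-$. Let $X$ be the graph obtained from the disjoint union of $G$ and $H$ by identifying $g_+$ with $h_+$ and $g_-$ with $h_-$; if this creates a double edge between the two identified vertices, those two edges are identified into one. Let $Y$ be obtained in the same way but identifying $g_+$ with $h_-$ and $g_-$ with $h_+$. Suppose that the two gluing points are adjacent in $X$, which happens exactly when $g_+$ is adjacent to $g_-$ in $G$ or $h_+$ is adjacent to $h_-$ in $H$, and equivalently exactly when they are adjacent in $Y$. Then $\#X = \#Y$.
   Context: A graph means a finite undirected graph with no loops or multiple edges; it may be disconnected. For vertices $x,y$ of a graph $G$, $d_G(x,y)$ is the length of a shortest path from $x$ to $y$, or $\infty$ if there is none. Let $Z_G(q)$ be the square matrix over $\mathbb{Z}[q]$, indexed by the vertices of $G$, with $(x,y)$-entry $q^{d_G(x,y)}$, using the convention $q^\infty=0$. It is invertible over $\mathbb{Q}(q)$. The magnitude of $G$ is $\#G = \sum_{x,y\in G} Z_G(q)^{-1}(x,y)\in\mathbb{Q}(q)$. Graphs $X$ and $Y$ constructed as in the statement are said to differ by a Whitney twist. *)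

theory Defs
  imports
    "HOL-Library.Extended_Nat"
    "HOL-Computational_Algebra.Computational_Algebra"
    "Graph_Theory.Graph_Theory"
begin

text \<open>
  Finite simple undirected graphs are the records satisfying \<^locale>\<open>pair_graph\<close>: finite vertex
  set, and a symmetric irreflexive set of arcs, an undirected edge being a pair of opposite arcs.
\<close>

definition adjacent :: "'a pair_pre_digraph \<Rightarrow> 'a \<Rightarrow> 'a \<Rightarrow> bool" where
  "adjacent G x y \<longleftrightarrow> (x, y) \<in> parcs G"

text \<open>The infimum over the empty set is \<open>\<infinity>\<close> in \<^typ>\<open>enat\<close>.\<close>

definition gdist :: "'a pair_pre_digraph \<Rightarrow> 'a \<Rightarrow> 'a \<Rightarrow> enat" where
  "gdist G x y = (INF p \<in> {p. pre_digraph.apath (with_proj G) x p y}. enat (length p))"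


text \<open>\<open>\<rat>(q)\<close> is the fraction field of \<open>\<rat>[q]\<close>.\<close>

type_synonym ratfun = "rat poly fract"

definition qvar :: ratfun where
  "qvar = to_fract [:0, 1:]"

definition qpow :: "enat \<Rightarrow> ratfun" where
  "qpow d = (case d of enat n \<Rightarrow> qvar ^ n | \<infinity> \<Rightarrow> 0)"

definition Zmat :: "'a pair_pre_digraph \<Rightarrow> 'a \<Rightarrow> 'a \<Rightarrow> ratfun" where
  "Zmat G x y = qpow (gdist G x y)"


text \<open>
  Square matrices indexed by a finite set \<open>V\<close> are functions of two arguments, of which only the
  values on \<open>V \<times> V\<close> matter. Requiring an inverse to vanish elsewhere makes it unique.
\<close>

definition is_inverse_on :: "'a set \<Rightarrow> ('a \<Rightarrow> 'a \<Rightarrow> 'k::field) \<Rightarrow> ('a \<Rightarrow> 'a \<Rightarrow> 'k) \<Rightarrow> bool" where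
  "is_inverse_on V A B \<longleftrightarrow>
     (\<forall>x\<in>V. \<forall>z\<in>V. (\<Sum>y\<in>V. A x y * B y z) = (if x = z then 1 else 0)) \<and>
     (\<forall>x\<in>V. \<forall>z\<in>V. (\<Sum>y\<in>V. B x y * A y z) = (if x = z then 1 else 0)) \<and>
     (\<forall>x y. x \<notin> V \<or> y \<notin> V \<longrightarrow> B x y = 0)"

definition inverse_on :: "'a set \<Rightarrow> ('a \<Rightarrow> 'a \<Rightarrow> 'k::field) \<Rightarrow> 'a \<Rightarrow> 'a \<Rightarrow> 'k" where
  "inverse_on V A = (THE B. is_inverse_on V A B)"

definition magnitude :: "'a pair_pre_digraph \<Rightarrow> ratfun" where
  "magnitude G =
     (\<Sum>x\<in>pverts G. \<Sum>y\<in>pverts G. inverse_on (pverts G) (Zmat G) x y)"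


definition disj_union ::
  "'a pair_pre_digraph \<Rightarrow> 'b pair_pre_digraph \<Rightarrow> ('a + 'b) pair_pre_digraph" where
  "disj_union G H =
     \<lparr> pverts = pverts G <+> pverts H,
       parcs = map_prod Inl Inl ` parcs G \<union> map_prod Inr Inr ` parcs H \<rparr>"

text \<open>
  Identifying \<open>a\<close> with \<open>c\<close> and \<open>b\<close> with \<open>d\<close> is done by choosing \<open>Inl a\<close> and \<open>Inl b\<close> as
  representatives of the two nontrivial classes, so these are the gluing points of
  \<open>glue G a b H c d\<close>. Arcs form a set, so a resulting double edge is merged into one.
\<close>

definition identify :: "'a \<Rightarrow> 'a \<Rightarrow> 'b \<Rightarrow> 'b \<Rightarrow> 'a + 'b \<Rightarrow> 'a + 'b" where
  "identify a b c d v = (if v = Inr c then Inl a else if v = Inr d then Inl b else v)"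

definition glue ::
  "'a pair_pre_digraph \<Rightarrow> 'a \<Rightarrow> 'a \<Rightarrow> 'b pair_pre_digraph \<Rightarrow> 'b \<Rightarrow> 'b \<Rightarrow> ('a + 'b) pair_pre_digraph" where
  "glue G a b H c d =
     \<lparr> pverts = identify a b c d ` pverts (disj_union G H),
       parcs = map_prod (identify a b c d) (identify a b c d) ` parcs (disj_union G H) \<rparr>"

lemma pair_graph_glue:
  assumes "pair_graph G" "a \<in> pverts G" "b \<in> pverts G" "a \<noteq> b"
    and "pair_graph H" "c \<in> pverts H" "d \<in> pverts H" "c \<noteq> d"
  shows "pair_graph (glue G a b H c d)"
proof -
  interpret G: pair_graph G by fact
  interpret H: pair_graph H by fact
  let ?f = "identify a b c d"
  have symG: "(x, y) \<in> parcs G \<Longrightarrow> (y, x) \<in> parcs G" for x y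
    using G.pair_sym_arcs by (auto simp: symmetric_def sym_def)
  have symH: "(x, y) \<in> parcs H \<Longrightarrow> (y, x) \<in> parcs H" for x y
    using H.pair_sym_arcs by (auto simp: symmetric_def sym_def)
  have loopG: "(x, x) \<notin> parcs G" for x using G.pair_no_loops by fastforce
  have loopH: "(x, x) \<notin> parcs H" for x using H.pair_no_loops by fastforce
  have arcs: "parcs (glue G a b H c d) =
      {(?f (Inl x), ?f (Inl y)) | x y. (x, y) \<in> parcs G} \<union>
      {(?f (Inr x), ?f (Inr y)) | x y. (x, y) \<in> parcs H}"
    by (force simp: glue_def disj_union_def image_Un)
  have verts: "pverts (glue G a b H c d) = ?f ` (Inl ` pverts G \<union> Inr ` pverts H)"
    by (simp add: glue_def disj_union_def Plus_def)
  show ?thesis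
  proof
    fix e assume "e \<in> parcs (glue G a b H c d)"
    then show "fst e \<in> pverts (glue G a b H c d)" "snd e \<in> pverts (glue G a b H c d)"
      unfolding arcs verts by (auto dest: G.wellformed' H.wellformed')
  next
    show "finite (pverts (glue G a b H c d))" "finite (parcs (glue G a b H c d))"
      using G.pair_finite_verts H.pair_finite_verts G.pair_finite_arcs H.pair_finite_arcs
      by (auto simp: glue_def disj_union_def)
  next
    show "symmetric (with_proj (glue G a b H c d))"
      unfolding symmetric_def with_proj_simps arcs sym_def using symG symH by blast
  next
    fix e assume "e \<in> parcs (glue G a b H c d)"
    then show "fst e \<noteq> snd e"
      unfolding arcs using loopG loopH \<open>a \<noteq> b\<close>
      by (auto simp: identify_def split: if_splits)
  qed
qed

end

theory Submission
  imports Defs "Jordan_Normal_Form.Determinant"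
begin

text \<open>
  The magnitude is the total weight of any solution \<open>w\<close> of \<open>Z w = 1\<close>. Write \<open>p\<close>, \<open>m\<close> for the gluing
  points. As they are adjacent, distances within either side are the same in \<open>X\<close> and \<open>Y\<close>, and
  \<open>d(x, p)\<close>, \<open>d(x, m)\<close> differ by at most 1; checking the cases then shows that for \<open>x\<close> in \<open>G\<close>
  and \<open>y\<close> in \<open>H\<close> the difference \<open>Z\<^sub>X(x, y) - Z\<^sub>Y(x, y)\<close> is the rank one expression
  \<open>(q^d(x,p) - q^d(x,m)) (q^d(p,y) - q^d(m,y)) / (1 - q)\<close>, with distances in \<open>X\<close>. Therefore moving
  a suitable amount of weight from \<open>m\<close> to \<open>p\<close> turns a solution for \<open>X\<close> into one for \<open>Y\<close> of the
  same total weight. Invertibility of \<open>Z\<close> follows from \<open>Z = 1\<close> at \<open>q = 0\<close>.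
\<close>

section \<open>Powers of relations as sets of walks\<close>

lemma relpow_preserve:
  assumes "\<And>x y. (x, y) \<in> R \<Longrightarrow> (f x, f y) \<in> S" "(x, y) \<in> R ^^ n"
  shows "(f x, f y) \<in> S ^^ n"
  using assms(2) by (induction n arbitrary: y) (auto intro: assms(1))

lemma sym_relpow:
  assumes "sym R"
  shows "sym (R ^^ n)"
proof (induction n)
  case (Suc n)
  then show ?case
    by (metis assms converse_relcomp relpow.simps(2) relpow_commute sym_conv_converse_eq)
qed (auto simp: sym_def)

text \<open>The last step of the walk that leaves \<open>A\<close> has its source in
  \<open>S\<close>; the walk is cut there.\<close>

lemma relpow_through_separator:
  assumes "(x, y) \<in> R ^^ n" "x \<in> A" "y \<notin> A"
    and sep: "\<And>u v. (u, v) \<in> R \<Longrightarrow> u \<in> A \<Longrightarrow> v \<notin> A \<Longrightarrow> u \<in> S"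
  shows "\<exists>s\<in>S. \<exists>i j. i + j = n \<and> (x, s) \<in> R ^^ i \<and> (s, y) \<in> R ^^ j"
  using assms(1,3)
proof (induction n arbitrary: y)
  case 0
  then show ?case using \<open>x \<in> A\<close> by simp
next
  case (Suc n)
  then obtain z where z: "(x, z) \<in> R ^^ n" "(z, y) \<in> R" by auto
  show ?case
  proof (cases "z \<in> A")
    case True
    with sep z Suc.prems have "z \<in> S" by blast
    moreover have "(z, y) \<in> R ^^ 1" using z by simp
    ultimately show ?thesis using z(1) by (metis Suc_eq_plus1)
  next
    case False
    with Suc.IH z obtain s i j
      where "s \<in> S" "i + j = n" "(x, s) \<in> R ^^ i" "(s, z) \<in> R ^^ j" by blast
    with z(2) show ?thesis by (metis add_Suc_right relpow_Suc_I)
  qed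
qed

text \<open>Reduces inequalities between distances to finite bounds, which
  \<open>gdist_le_iff\<close> turns into statements about powers of a relation.\<close>

lemma enat_le_fromI:
  assumes "\<And>n. b \<le> enat n \<Longrightarrow> a \<le> enat n"
  shows "a \<le> b"
  using assms by (cases b) auto


section \<open>Graph distance\<close>

lemma (in pair_wf_digraph) awalk_imp_relpow:
  assumes "awalk x p y"
  shows "(x, y) \<in> parcs G ^^ length p"
  using assms
proof (induction p arbitrary: x)
  case (Cons e p)
  then show ?case by (cases e) (auto simp: awalk_Cons_iff simp del: relpow.simps intro: relpow_Suc_I2)
qed (auto simp: awalk_Nil_iff)

lemma (in pair_wf_digraph) reflcl_relpow_imp_awalk:
  assumes "(x, y) \<in> ((parcs G)\<^sup>=) ^^ n" "x \<in> pverts G"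
  shows "\<exists>p. awalk x p y \<and> length p \<le> n"
  using assms(1)
proof (induction n arbitrary: y)
  case 0
  then show ?case using assms(2) by (auto simp: awalk_Nil_iff intro!: exI[of _ "[]"])
next
  case (Suc n)
  then obtain z where z: "(x, z) \<in> ((parcs G)\<^sup>=) ^^ n" "(z, y) \<in> (parcs G)\<^sup>=" by auto
  with Suc.IH obtain p where p: "awalk x p z" "length p \<le> n" by blast
  show ?case
  proof (cases "z = y")
    case True
    with p show ?thesis using le_SucI by blast
  next
    case False
    with z have "(z, y) \<in> parcs G" by auto
    then have "awalk z [(z, y)] y" using arc_implies_awalk[of "(z, y)"] by simp
    with p have "awalk x (p @ [(z, y)]) y" by (blast intro: awalk_appendI)
    moreover have "length (p @ [(z, y)]) \<le> Suc n" using p by simp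
    ultimately show ?thesis by blast
  qed
qed

text \<open>The reflexive closure lets a walk pause, so its \<open>n\<close>-th power describes
  walks of at most \<open>n\<close> arcs. That \<open>gdist\<close> ranges over paths does not
  matter, as a walk can be cut down to a path.\<close>

lemma (in pair_wf_digraph) gdist_le_iff:
  assumes "x \<in> pverts G"
  shows "gdist G x y \<le> enat n \<longleftrightarrow> (x, y) \<in> ((parcs G)\<^sup>=) ^^ n"
proof
  assume le: "gdist G x y \<le> enat n"
  let ?D = "(\<lambda>p. enat (length p)) ` {p. apath x p y}"
  have "?D \<noteq> {}"
  proof
    assume "?D = {}"
    then have "gdist G x y = \<infinity>" by (simp add: gdist_def top_enat_def)
    with le show False by simp
  qed
  then have "Inf ?D \<in> ?D" by (auto simp: Inf_enat_def intro: LeastI)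
  then obtain p where p: "apath x p y" "gdist G x y = enat (length p)"
    by (auto simp: gdist_def)
  then have "(x, y) \<in> parcs G ^^ length p" using awalk_imp_relpow awalkI_apath by blast
  then have walk: "(x, y) \<in> ((parcs G)\<^sup>=) ^^ length p"
    by (rule relpow_preserve[of _ id, simplified, rotated]) auto
  have "(y, y) \<in> ((parcs G)\<^sup>=) ^^ k" for k
    by (induction k) auto
  then have "(x, y) \<in> ((parcs G)\<^sup>=) ^^ (length p + (n - length p))"
    using walk unfolding relpow_add by blast
  then show "(x, y) \<in> ((parcs G)\<^sup>=) ^^ n" using le p by simp
next
  assume "(x, y) \<in> ((parcs G)\<^sup>=) ^^ n"
  then obtain p where p: "awalk x p y" "length p \<le> n"
    using reflcl_relpow_imp_awalk assms by blast
  let ?q = "awalk_to_apath p"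
  have q: "apath x ?q y" using p by (simp add: apath_awalk_to_apath)
  \<comment> \<open>The path repeats no arc and uses only arcs of \<open>p\<close>, so counting arcs
    bounds its length.\<close>
  then have "distinct ?q" by (metis apath_def distinct_verts_imp_distinct)
  then have "length ?q = card (set ?q)" by (simp add: distinct_card)
  also have "\<dots> \<le> card (set p)" using p(1) by (intro card_mono awalk_to_apath_subset) auto
  also have "\<dots> \<le> length p" by (rule card_length)
  finally have "length ?q \<le> n" using p by simp
  moreover have "gdist G x y \<le> enat (length ?q)"
    unfolding gdist_def using q by (intro INF_lower) simp
  ultimately show "gdist G x y \<le> enat n" by (meson enat_ord_simps(1) order_trans)
qed

text \<open>Pauses are harmless, so \<open>f\<close> may contract arcs to vertices; the maps that
  collapse one side of a gluing do so.\<close>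

lemma gdist_hom_le:
  assumes "pair_wf_digraph X" "pair_wf_digraph Y" "x \<in> pverts X" "f x \<in> pverts Y"
    and "\<And>u v. (u, v) \<in> parcs X \<Longrightarrow> (f u, f v) \<in> (parcs Y)\<^sup>="
  shows "gdist Y (f x) (f y) \<le> gdist X x y"
proof (rule enat_le_fromI)
  fix n assume "gdist X x y \<le> enat n"
  then have "(x, y) \<in> ((parcs X)\<^sup>=) ^^ n" using assms by (simp add: pair_wf_digraph.gdist_le_iff)
  then have "(f x, f y) \<in> ((parcs Y)\<^sup>=) ^^ n"
    by (rule relpow_preserve[rotated]) (use assms in auto)
  then show "gdist Y (f x) (f y) \<le> enat n"
    using assms by (simp add: pair_wf_digraph.gdist_le_iff)
qed

context pair_graph
begin

lemma gdist_sym: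
  assumes "x \<in> pverts G" "y \<in> pverts G"
  shows "gdist G x y = gdist G y x"
proof -
  have "sym ((parcs G)\<^sup>=)"
    using pair_sym_arcs by (auto simp: symmetric_def sym_def)
  then have "(x, y) \<in> ((parcs G)\<^sup>=) ^^ n \<longleftrightarrow> (y, x) \<in> ((parcs G)\<^sup>=) ^^ n" for n
    by (meson symE sym_relpow)
  with assms have "gdist G x y \<le> enat n \<longleftrightarrow> gdist G y x \<le> enat n" for n
    by (simp add: gdist_le_iff)
  then show ?thesis by (meson antisym enat_le_fromI)
qed

lemma gdist_self: "x \<in> pverts G \<Longrightarrow> gdist G x x = 0"
  using gdist_le_iff[of x x 0] by (simp add: zero_enat_def[symmetric])

lemma gdist_eq_0_iff: "x \<in> pverts G \<Longrightarrow> gdist G x y = 0 \<longleftrightarrow> x = y"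
  using gdist_le_iff[of x y 0] by (simp add: zero_enat_def[symmetric])

lemma gdist_adjacent: "(x, y) \<in> parcs G \<Longrightarrow> gdist G x y = 1"
proof -
  assume xy: "(x, y) \<in> parcs G"
  then have x: "x \<in> pverts G" "x \<noteq> y" using wellformed' pair_no_loops[OF xy] by auto
  then have "gdist G x y \<le> 1" using gdist_le_iff[of x y 1] xy by (simp add: one_enat_def)
  moreover have "gdist G x y \<noteq> 0" using x by (simp add: gdist_eq_0_iff)
  ultimately show ?thesis 
    by (cases "gdist G x y") (auto simp: one_enat_def zero_enat_def)
qed

lemma gdist_triangle:
  assumes "x \<in> pverts G" "y \<in> pverts G"
  shows "gdist G x z \<le> gdist G x y + gdist G y z"
proof (rule enat_le_fromI)
  fix n assume n: "gdist G x y + gdist G y z \<le> enat n"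
  then have "gdist G x y + gdist G y z \<noteq> \<infinity>" using enat_ile by fastforce
  then have "gdist G x y \<noteq> \<infinity>" "gdist G y z \<noteq> \<infinity>"
    by (auto simp: plus_eq_infty_iff_enat simp del: not_infinity_eq)
  then obtain i j where ij: "gdist G x y = enat i" "gdist G y z = enat j"
    unfolding not_infinity_eq by blast
  then have "(x, y) \<in> ((parcs G)\<^sup>=) ^^ i" "(y, z) \<in> ((parcs G)\<^sup>=) ^^ j"
    using gdist_le_iff[OF assms(1), of y i] gdist_le_iff[OF assms(2), of z j] by simp_all
  then have "(x, z) \<in> ((parcs G)\<^sup>=) ^^ (i + j)" unfolding relpow_add by blast
  then have "gdist G x z \<le> enat (i + j)" using assms gdist_le_iff by blast
  then show "gdist G x z \<le> enat n" using n unfolding ij by (simp add: order.trans)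
qed

text \<open>One inequality is the triangle inequality through \<open>p\<close> and through
  \<open>m\<close>; for the other, any walk out of \<open>A\<close> leaves it from \<open>p\<close>
  or \<open>m\<close> and splits there.\<close>

lemma gdist_separator:
  assumes "x \<in> A" "y \<notin> A" "x \<in> pverts G" "p \<in> pverts G" "m \<in> pverts G"
    and sep: "\<And>u v. (u, v) \<in> parcs G \<Longrightarrow> u \<in> A \<Longrightarrow> v \<notin> A \<Longrightarrow> u \<in> {p, m}"
  shows "gdist G x y = min (gdist G x p + gdist G p y) (gdist G x m + gdist G m y)"
proof (rule antisym)
  show "gdist G x y \<le> min (gdist G x p + gdist G p y) (gdist G x m + gdist G m y)"
    using gdist_triangle[OF assms(3,4)] gdist_triangle[OF assms(3,5)] by simp
next
  show "min (gdist G x p + gdist G p y) (gdist G x m + gdist G m y) \<le> gdist G x y"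
  proof (rule enat_le_fromI)
    fix n assume "gdist G x y \<le> enat n"
    then have "(x, y) \<in> ((parcs G)\<^sup>=) ^^ n" using assms gdist_le_iff by blast
    from relpow_through_separator[OF this assms(1,2), of "{p, m}"] sep
    obtain s i j where s: "s \<in> {p, m}" "i + j = n"
      "(x, s) \<in> ((parcs G)\<^sup>=) ^^ i" "(s, y) \<in> ((parcs G)\<^sup>=) ^^ j" by blast
    then have "gdist G x s \<le> enat i" "gdist G s y \<le> enat j"
      using gdist_le_iff[of x s i] gdist_le_iff[of s y j] assms(3-5) by auto
    then have "gdist G x s + gdist G s y \<le> enat n"
      using add_mono s(2) by (metis plus_enat_simps(1))
    then show "min (gdist G x p + gdist G p y) (gdist G x m + gdist G m y) \<le> enat n"
      using s(1) unfolding min_le_iff_disj by blast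
  qed
qed

end


section \<open>Invertibility and weightings\<close>

lemma is_inverse_onD:
  assumes "is_inverse_on V A B"
  shows "x \<in> V \<Longrightarrow> z \<in> V \<Longrightarrow> (\<Sum>y\<in>V. A x y * B y z) = (if x = z then 1 else 0)"
    and "x \<in> V \<Longrightarrow> z \<in> V \<Longrightarrow> (\<Sum>y\<in>V. B x y * A y z) = (if x = z then 1 else 0)"
    and "x \<notin> V \<or> y \<notin> V \<Longrightarrow> B x y = 0"
  using assms unfolding is_inverse_on_def by blast+

text \<open>On \<open>V\<close> this is \<open>B = B (A C) = (B A) C = C\<close>; elsewhere both
  vanish, which makes the \<open>THE\<close> in \<open>inverse_on\<close> well determined.\<close>

lemma is_inverse_on_unique:
  assumes "finite V" "is_inverse_on V A B" "is_inverse_on V A C"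
  shows "B = C"
proof (intro ext)
  fix x z
  show "B x z = C x z"
  proof (cases "x \<in> V \<and> z \<in> V")
    case True
    have "B x z = (\<Sum>y\<in>V. B x y * (if y = z then 1 else 0))"
      using True assms(1) by (simp add: mult_delta_right)
    also have "\<dots> = (\<Sum>y\<in>V. B x y * (\<Sum>t\<in>V. A y t * C t z))"
      using True by (intro sum.cong refl) (simp only: is_inverse_onD(1)[OF assms(3)])
    also have "\<dots> = (\<Sum>t\<in>V. (\<Sum>y\<in>V. B x y * A y t) * C t z)"
      by (simp add: sum_distrib_left sum_distrib_right mult.assoc) (rule sum.swap)
    also have "\<dots> = (\<Sum>t\<in>V. (if x = t then 1 else 0) * C t z)"
      using True by (intro sum.cong refl) (simp only: is_inverse_onD(2)[OF assms(2)])
    also have "\<dots> = C x z"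
      using True assms(1) by (simp add: mult_delta_left)
    finally show ?thesis .
  next
    case False
    then show ?thesis using is_inverse_onD(3)[OF assms(2)] is_inverse_onD(3)[OF assms(3)] by auto
  qed
qed

lemma inverse_on_eq:
  assumes "finite V" "is_inverse_on V A B"
  shows "inverse_on V A = B"
  unfolding inverse_on_def using assms is_inverse_on_unique by blast

text \<open>Evaluation at 0 commutes with the determinant, so the determinant is a polynomial with
  value 1 at 0. It is therefore nonzero, also in the fraction field. An enumeration \<open>f\<close>
  of \<open>V\<close> carries this to matrices indexed by numbers.\<close>

lemma is_inverse_on_exists:
  fixes P :: "'a \<Rightarrow> 'a \<Rightarrow> rat poly"
  assumes "finite V"
    and "\<And>x y. x \<in> V \<Longrightarrow> y \<in> V \<Longrightarrow> poly (P x y) 0 = (if x = y then 1 else 0)"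
  shows "\<exists>B. is_inverse_on V (\<lambda>x y. to_fract (P x y)) B"
proof -
  define n where "n = card V"
  obtain f where f: "bij_betw f {0..<n} V"
    using assms(1) n_def ex_bij_betw_nat_finite by blast
  define g where "g = inv_into {0..<n} f"
  have g: "bij_betw g V {0..<n}" unfolding g_def using f by (rule bij_betw_inv_into)
  have fg: "f (g x) = x" "g x < n" if "x \<in> V" for x
    using that f g by (auto simp: g_def bij_betw_inv_into_right dest: bij_betwE)
  have f_in: "f i \<in> V" if "i < n" for i using that f by (auto dest: bij_betwE)
  have g_inj: "g x = g y \<longleftrightarrow> x = y" if "x \<in> V" "y \<in> V" for x y
    using that fg by metis
  have f_inj: "f i = f j \<longleftrightarrow> i = j" if "i < n" "j < n" for i j
    using that f by (metis bij_betw_imp_inj_on atLeastLessThan_iff inj_on_eq_iff zero_le)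
  define M where "M = mat n n (\<lambda>(i, j). P (f i) (f j))"
  interpret eval: comm_ring_hom "\<lambda>p :: rat poly. poly p 0" by unfold_locales auto
  interpret emb: comm_ring_hom "to_fract :: rat poly \<Rightarrow> _" by unfold_locales auto
  have "map_mat (\<lambda>p. poly p 0) M = 1\<^sub>m n"
    by (rule eq_matI) (auto simp: M_def assms(2) f_in f_inj)
  then have "poly (det M) 0 = 1" by (metis det_one eval.hom_det)
  then have "det M \<noteq> 0" by auto
  then have "det (map_mat to_fract M) \<noteq> 0" by simp
  moreover have carr: "map_mat to_fract M \<in> carrier_mat n n" by (simp add: M_def)
  ultimately obtain N where N: "N \<in> carrier_mat n n"
    "N * map_mat to_fract M = 1\<^sub>m n" "map_mat to_fract M * N = 1\<^sub>m n"
    using det_non_zero_imp_unit[OF carr, of "()"] unfolding Units_def ring_mat_def by auto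
  define B where "B x y = (if x \<in> V \<and> y \<in> V then N $$ (g x, g y) else 0)" for x y
  have reindex: "(\<Sum>y\<in>V. h (g y)) = (\<Sum>i = 0..<n. h i)" for h :: "nat \<Rightarrow> rat poly fract"
    using g by (rule sum.reindex_bij_betw)
  have M_g: "map_mat to_fract M $$ (g x, g y) = to_fract (P x y)" if "x \<in> V" "y \<in> V" for x y
    using that by (simp add: M_def fg)
  have prod_entry: "(\<Sum>y\<in>V. C $$ (g x, g y) * D $$ (g y, g z)) = (C * D) $$ (g x, g z)"
    if "x \<in> V" "z \<in> V" "C \<in> carrier_mat n n" "D \<in> carrier_mat n n"
    for x z and C D :: "rat poly fract mat"
    using that fg reindex[of "\<lambda>i. C $$ (g x, i) * D $$ (i, g z)"]
    by (simp add: scalar_prod_def)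
  have "(\<Sum>y\<in>V. to_fract (P x y) * B y z) = (if x = z then 1 else 0)"
    "(\<Sum>y\<in>V. B x y * to_fract (P y z)) = (if x = z then 1 else 0)" if xz: "x \<in> V" "z \<in> V" for x z
  proof -
    have "(\<Sum>y\<in>V. to_fract (P x y) * B y z) = (map_mat to_fract M * N) $$ (g x, g z)"
      unfolding prod_entry[OF xz carr N(1), symmetric]
      by (intro sum.cong refl) (simp add: xz M_g B_def del: index_map_mat)
    also have "\<dots> = (if x = z then 1 else 0)" unfolding N(3) using xz by (simp add: fg g_inj)
    finally show "(\<Sum>y\<in>V. to_fract (P x y) * B y z) = (if x = z then 1 else 0)" .
    have "(\<Sum>y\<in>V. B x y * to_fract (P y z)) = (N * map_mat to_fract M) $$ (g x, g z)"
      unfolding prod_entry[OF xz N(1) carr, symmetric]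
      by (intro sum.cong refl) (simp add: xz M_g B_def del: index_map_mat)
    also have "\<dots> = (if x = z then 1 else 0)" unfolding N(2) using xz by (simp add: fg g_inj)
    finally show "(\<Sum>y\<in>V. B x y * to_fract (P y z)) = (if x = z then 1 else 0)" .
  qed
  then have "is_inverse_on V (\<lambda>x y. to_fract (P x y)) B"
    unfolding is_inverse_on_def by (auto simp: B_def)
  then show ?thesis by blast
qed

lemma qpow_0 [simp]: "qpow 0 = 1"
  by (simp add: qpow_def zero_enat_def)

lemma qpow_1 [simp]: "qpow 1 = qvar"
  by (simp add: qpow_def one_enat_def)

lemma one_minus_qvar_nonzero: "1 - qvar \<noteq> 0"
proof -
  have "1 - qvar = to_fract (1 - [:0, 1:])" by (simp add: qvar_def)
  moreover have "1 - [:0, 1:] \<noteq> (0 :: rat poly)" by (simp add: one_pCons)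
  ultimately show ?thesis by (metis to_fract_eq_0_iff)
qed

lemma (in pair_graph) Zmat_invertible:
  "\<exists>B. is_inverse_on (pverts G) (Zmat G) B"
proof -
  define P where "P x y = (case gdist G x y of enat n \<Rightarrow> [:0, 1:] ^ n | \<infinity> \<Rightarrow> (0 :: rat poly))" for x y
  have to_fract_power: "to_fract (p ^ n) = to_fract p ^ n" for p :: "rat poly" and n
    by (induction n) auto
  have "Zmat G = (\<lambda>x y. to_fract (P x y))"
    by (intro ext) (simp add: P_def Zmat_def qpow_def qvar_def to_fract_power split: enat.split)
  moreover have "poly (P x y) 0 = (if x = y then 1 else 0)" if "x \<in> pverts G" for x y
    using gdist_eq_0_iff[OF that, of y]
    by (auto simp: P_def zero_enat_def power_0_left split: enat.split)
  ultimately show ?thesis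
    using is_inverse_on_exists[OF pair_finite_verts, of P] by simp
qed

text \<open>With \<open>B\<close> the inverse of \<open>Z\<close>, summing the entries of
  \<open>B 1 = B (Z w) = w\<close> gives the claim.\<close>

lemma (in pair_graph) magnitude_eq_weighting:
  assumes "\<And>x. x \<in> pverts G \<Longrightarrow> (\<Sum>y\<in>pverts G. Zmat G x y * w y) = 1"
  shows "magnitude G = (\<Sum>y\<in>pverts G. w y)"
proof -
  let ?V = "pverts G"
  obtain B where B: "is_inverse_on ?V (Zmat G) B" using Zmat_invertible by blast
  have "magnitude G = (\<Sum>x\<in>?V. \<Sum>y\<in>?V. B x y)"
    unfolding magnitude_def using B inverse_on_eq pair_finite_verts by metis
  also have "\<dots> = (\<Sum>x\<in>?V. \<Sum>y\<in>?V. B x y * (\<Sum>z\<in>?V. Zmat G y z * w z))"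
    by (simp add: assms)
  also have "\<dots> = (\<Sum>x\<in>?V. \<Sum>z\<in>?V. (\<Sum>y\<in>?V. B x y * Zmat G y z) * w z)"
    by (rule sum.cong[OF refl], simp add: sum_distrib_left sum_distrib_right mult.assoc) (rule sum.swap)
  also have "\<dots> = (\<Sum>x\<in>?V. \<Sum>z\<in>?V. (if x = z then 1 else 0) * w z)"
    by (intro sum.cong refl) (simp only: is_inverse_onD(2)[OF B])
  also have "\<dots> = (\<Sum>x\<in>?V. w x)"
    using pair_finite_verts by (simp add: mult_delta_left)
  finally show ?thesis .
qed

text \<open>The row sums of the inverse form such a \<open>w\<close>.\<close>

lemma (in pair_graph) weighting_exists:
  "\<exists>w. \<forall>x\<in>pverts G. (\<Sum>y\<in>pverts G. Zmat G x y * w y) = 1"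
proof -
  let ?V = "pverts G"
  obtain B where B: "is_inverse_on ?V (Zmat G) B" using Zmat_invertible by blast
  have "(\<Sum>y\<in>?V. Zmat G x y * (\<Sum>z\<in>?V. B y z)) = 1" if x: "x \<in> ?V" for x
  proof -
    have "(\<Sum>y\<in>?V. Zmat G x y * (\<Sum>z\<in>?V. B y z)) = (\<Sum>z\<in>?V. \<Sum>y\<in>?V. Zmat G x y * B y z)"
      by (simp add: sum_distrib_left) (rule sum.swap)
    also have "\<dots> = (\<Sum>z\<in>?V. if x = z then 1 else 0)"
      using x by (intro sum.cong refl) (simp only: is_inverse_onD(1)[OF B])
    also have "\<dots> = 1" using x pair_finite_verts by simp
    finally show ?thesis .
  qed
  then show ?thesis by (intro exI[of _ "\<lambda>y. \<Sum>z\<in>?V. B y z"]) blast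
qed


section \<open>The two gluings\<close>

text \<open>Here \<open>a\<close>, \<open>b\<close> are the distances from one vertex to the gluing
  points, and \<open>c\<close>, \<open>e\<close> those from a vertex on the other side. If
  \<open>a = b\<close> or \<open>c = e\<close>, both sides vanish; in the other finite cases both
  are \<open>(1 - q)^2 q^(min a b + min c e)\<close> up to a common sign. Infinite distances occur
  in pairs and make every term 0.\<close>

lemma qpow_twist:
  assumes "a \<le> b + 1" "b \<le> a + 1" "c \<le> e + 1" "e \<le> c + 1"
  shows "(1 - qvar) * (qpow (min (a + c) (b + e)) - qpow (min (a + e) (b + c))) =
    (qpow a - qpow b) * (qpow c - qpow e)"
proof (cases "a = \<infinity> \<or> c = \<infinity>")
  case True
  then have "a = \<infinity> \<and> b = \<infinity> \<or> c = \<infinity> \<and> e = \<infinity>"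
    using assms by (cases a; cases b; cases c; cases e) (auto simp: one_enat_def)
  then show ?thesis by (auto simp: qpow_def)
next
  case False
  then obtain i j k l where eqs: "a = enat i" "b = enat j" "c = enat k" "e = enat l"
    using assms by (cases a; cases b; cases c; cases e) (auto simp: one_enat_def)
  with assms have "j = i \<or> j = Suc i \<or> i = Suc j" "k = l \<or> k = Suc l \<or> l = Suc k"
    by (auto simp: one_enat_def)
  then show ?thesis
    unfolding eqs by (elim disjE) (simp_all add: qpow_def min_def power_add algebra_simps)
qed

text \<open>The new weighting differs from \<open>w\<close> only by adding some \<open>\<alpha>\<close> at \<open>p\<close> and subtracting it at \<open>m\<close>.
  The rows in \<open>P \<union> {p, m}\<close> determine \<open>\<alpha>\<close> from the weights on \<open>W\<close>, those in \<open>W\<close> (where the columns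
  \<open>p\<close> and \<open>m\<close> change places) from the weights on \<open>P\<close>; subtracting the equations for \<open>w\<close> in the
  rows \<open>p\<close> and \<open>m\<close> shows that the two requirements agree.\<close>

lemma twisted_weighting:
  fixes A B :: "'v \<Rightarrow> 'v \<Rightarrow> 'k :: field" and w :: "'v \<Rightarrow> 'k"
  assumes fin: "finite P" "finite W"
    and disj: "P \<inter> W = {}" "p \<notin> P" "m \<notin> P" "p \<notin> W" "m \<notin> W" "p \<noteq> m"
    and V: "V = P \<union> W \<union> {p, m}"
    and r: "r \<noteq> 0"
    and A_pm: "A p p = 1" "A m m = 1" "A p m = 1 - r" "A m p = 1 - r"
    and PP: "\<And>x y. x \<in> P \<union> {p, m} \<Longrightarrow> y \<in> P \<union> {p, m} \<Longrightarrow> B x y = A x y"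
    and WW: "\<And>x y. x \<in> W \<Longrightarrow> y \<in> W \<Longrightarrow> B x y = A x y"
    and W_pm: "\<And>x. x \<in> W \<Longrightarrow> B x p = A x m" "\<And>x. x \<in> W \<Longrightarrow> B x m = A x p"
    and PW: "\<And>x y. x \<in> P \<union> {p, m} \<Longrightarrow> y \<in> W \<Longrightarrow>
      r * (A x y - B x y) = (A x p - A x m) * (A p y - A m y)"
    and WP: "\<And>x y. x \<in> W \<Longrightarrow> y \<in> P \<Longrightarrow>
      r * (A x y - B x y) = (A x p - A x m) * (A p y - A m y)"
    and w: "\<And>x. x \<in> V \<Longrightarrow> (\<Sum>y\<in>V. A x y * w y) = 1"
  shows "\<exists>w'. (\<forall>x\<in>V. (\<Sum>y\<in>V. B x y * w' y) = 1) \<and> sum w' V = sum w V"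
proof -
  have split: "sum f V = sum f P + sum f W + f p + f m" for f :: "'v \<Rightarrow> 'k"
    unfolding V using fin disj by (simp add: sum.union_disjoint add_ac)
  \<comment> \<open>These are the contributions of \<open>P\<close> and \<open>W\<close> to row
    \<open>p\<close> minus row \<open>m\<close> of \<open>A w\<close>. The columns \<open>p\<close>
    and \<open>m\<close> contribute \<open>r * (w p - w m)\<close>, and the total is 1 - 1 =
    0.\<close>
  define rP where "rP = (\<Sum>y\<in>P. (A p y - A m y) * w y)"
  define rW where "rW = (\<Sum>y\<in>W. (A p y - A m y) * w y)"
  have "p \<in> V" "m \<in> V" using V by auto
  note eqs = w[OF this(1), unfolded split A_pm] w[OF this(2), unfolded split A_pm]
  have "rP + rW + r * (w p - w m) =
      (sum (\<lambda>y. A p y * w y) P + sum (\<lambda>y. A p y * w y) W + 1 * w p + (1 - r) * w m)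
      - (sum (\<lambda>y. A m y * w y) P + sum (\<lambda>y. A m y * w y) W + (1 - r) * w p + 1 * w m)"
    by (simp add: rP_def rW_def sum_subtractf algebra_simps)
  also have "\<dots> = 0" unfolding eqs by simp
  finally have "rP + rW + r * (w p - w m) = 0" .
  then have balance: "w p + rW / r = w m - rP / r"
    using r by (simp add: field_simps)
  \<comment> \<open>In a row \<open>x\<close> outside \<open>W\<close>, replacing \<open>A\<close>
    by \<open>B\<close> loses \<open>(A x p - A x m) * (rW / r)\<close>; moving
    \<open>rW / r\<close> from \<open>m\<close> to \<open>p\<close> restores exactly this.\<close>
  define w' where "w' = w(p := w p + rW / r, m := w m - rW / r)"
  have w'_P: "sum (\<lambda>y. f y * w' y) P = sum (\<lambda>y. f y * w y) P"
    and w'_W: "sum (\<lambda>y. f y * w' y) W = sum (\<lambda>y. f y * w y) W" for f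
    using disj by (auto simp: w'_def intro!: sum.cong)
  \<comment> \<open>By \<open>balance\<close>, \<open>w'\<close> also arises from exchanging the
    weights at \<open>p\<close> and \<open>m\<close> and then moving \<open>rP / r\<close> from
    \<open>p\<close> to \<open>m\<close>. This second form suits the rows in
    \<open>W\<close>.\<close>
  have w'_p: "w' p = w p + rW / r" "w' p = w m - rP / r"
    and w'_m: "w' m = w m - rW / r" "w' m = w p + rP / r"
    using disj balance by (auto simp: w'_def algebra_simps)
  have twist: "(\<Sum>y\<in>Q. B x y * w y) =
      (\<Sum>y\<in>Q. A x y * w y) - (A x p - A x m) * ((\<Sum>y\<in>Q. (A p y - A m y) * w y) / r)"
    if "\<And>y. y \<in> Q \<Longrightarrow> r * (A x y - B x y) = (A x p - A x m) * (A p y - A m y)" for x Q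
  proof -
    have "B x y * w y = A x y * w y - (A x p - A x m) * ((A p y - A m y) * w y) / r"
      if "y \<in> Q" for y
    proof -
      have "B x y = A x y - (A x p - A x m) * (A p y - A m y) / r"
        using r by (simp flip: \<open>\<And>y. y \<in> Q \<Longrightarrow> r * (A x y - B x y) = _ y\<close>[OF that])
      then show ?thesis by (simp add: left_diff_distrib mult.assoc)
    qed
    then show ?thesis
      by (simp add: sum_subtractf sum_distrib_left sum_divide_distrib)
  qed
  have "(\<Sum>y\<in>V. B x y * w' y) = 1" if x: "x \<in> V" for x
  proof (cases "x \<in> W")
    case True
    have twist_P: "(\<Sum>y\<in>P. B x y * w y) =
        (\<Sum>y\<in>P. A x y * w y) - (A x p - A x m) * (rP / r)"
      unfolding rP_def by (rule twist) (rule WP[OF True])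
    \<comment> \<open>The exchanged columns \<open>p\<close> and \<open>m\<close> meet the exchanged
      weights, and the two corrections by \<open>rP / r\<close> cancel.\<close>
    have "(\<Sum>y\<in>V. B x y * w' y) = (\<Sum>y\<in>P. A x y * w y) - (A x p - A x m) * (rP / r)
        + (\<Sum>y\<in>W. A x y * w y) + A x m * (w m - rP / r) + A x p * (w p + rP / r)"
      unfolding split w'_P w'_W w'_p(2) w'_m(2) twist_P W_pm[OF True]
      using WW[OF True] by simp
    also have "\<dots> = (\<Sum>y\<in>V. A x y * w y)" unfolding split by (simp add: algebra_simps)
    finally show ?thesis using w[OF x] by simp
  next
    case False
    then have x': "x \<in> P \<union> {p, m}" using x V by auto
    have twist_W: "(\<Sum>y\<in>W. B x y * w y) =
        (\<Sum>y\<in>W. A x y * w y) - (A x p - A x m) * (rW / r)"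
      unfolding rW_def by (rule twist) (rule PW[OF x'])
    have "(\<Sum>y\<in>V. B x y * w' y) = (\<Sum>y\<in>P. A x y * w y)
        + ((\<Sum>y\<in>W. A x y * w y) - (A x p - A x m) * (rW / r))
        + A x p * (w p + rW / r) + A x m * (w m - rW / r)"
      unfolding split w'_P w'_W w'_p(1) w'_m(1) twist_W
      using PP[OF x'] by simp
    also have "\<dots> = (\<Sum>y\<in>V. A x y * w y)" unfolding split by (simp add: algebra_simps)
    finally show ?thesis using w[OF x] by simp
  qed
  moreover have "sum w' V = sum w V"
    using w'_P[of "\<lambda>_. 1"] w'_W[of "\<lambda>_. 1"] by (simp add: split w'_p(1) w'_m(1))
  ultimately show ?thesis by blast
qed

section \<open>Vertices, arcs and adjacency in a glued graph\<close>

lemma pverts_glue: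
  assumes "a \<in> pverts G" "b \<in> pverts G"
  shows "pverts (glue G a b H c d) = Inl ` pverts G \<union> Inr ` (pverts H - {c, d})"
  using assms by (auto simp: glue_def disj_union_def identify_def image_iff split: if_splits)

lemma parcs_glue:
  "parcs (glue G a b H c d) = map_prod Inl Inl ` parcs G \<union>
    (\<lambda>(x, y). (identify a b c d (Inr x), identify a b c d (Inr y))) ` parcs H"
proof -
  have "identify a b c d (Inl x) = Inl x" for x by (simp add: identify_def)
  then show ?thesis
    by (simp add: glue_def disj_union_def image_Un image_image map_prod_def case_prod_unfold)
qed

lemma parcs_glueE:
  assumes "(u, v) \<in> parcs (glue G a b H c d)"
  obtains (left) x y where "(x, y) \<in> parcs G" "u = Inl x" "v = Inl y"
    | (right) x y where "(x, y) \<in> parcs H"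
        "u = identify a b c d (Inr x)" "v = identify a b c d (Inr y)"
  using assms unfolding parcs_glue by auto

lemma adjacent_glue_iff:
  assumes "a \<noteq> b" "c \<noteq> d"
  shows "adjacent (glue G a b H c d) (Inl a) (Inl b) \<longleftrightarrow> adjacent G a b \<or> adjacent H c d"
proof -
  have "Inl a = identify a b c d (Inr x) \<longleftrightarrow> x = c" "Inl b = identify a b c d (Inr x) \<longleftrightarrow> x = d" for x
    using assms by (auto simp: identify_def)
  then show ?thesis
    unfolding adjacent_def parcs_glue by (auto simp: image_iff Bex_def)
qed

section \<open>Distances and magnitude under the twist\<close>

locale glued_pair =
  G: pair_graph G + H: pair_graph H
  for G :: "'a pair_pre_digraph" and a b and H :: "'b pair_pre_digraph" and c d +
  assumes ab: "a \<in> pverts G" "b \<in> pverts G" "a \<noteq> b"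
    and cd: "c \<in> pverts H" "d \<in> pverts H" "c \<noteq> d"
    and adj: "adjacent G a b \<or> adjacent H c d"
begin

abbreviation X :: "('a + 'b) pair_pre_digraph" where "X \<equiv> glue G a b H c d"
abbreviation Y :: "('a + 'b) pair_pre_digraph" where "Y \<equiv> glue G a b H d c"

text \<open>Exchanging \<open>c\<close> and \<open>d\<close> interchanges \<open>X\<close> and
  \<open>Y\<close>, so each inequality proved from \<open>X\<close> to \<open>Y\<close> also yields
  its converse.\<close>

lemma swap: "glued_pair G a b H d c"
proof unfold_locales
  show "adjacent G a b \<or> adjacent H d c"
    using adj H.pair_sym_arcs by (auto simp: adjacent_def symmetric_def sym_def)
qed (use ab cd in auto)

sublocale X: pair_graph X
  using pair_graph_glue G.pair_graph_axioms H.pair_graph_axioms ab cd by metis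

sublocale Y: pair_graph Y
  using pair_graph_glue G.pair_graph_axioms H.pair_graph_axioms ab cd by metis

text \<open>Both gluings represent the gluing points by \<open>Inl a\<close> and
  \<open>Inl b\<close>, so the two matrices share an index set and weights can be carried
  over.\<close>

lemma pverts_Y: "pverts Y = pverts X"
  using ab by (auto simp: pverts_glue)

lemma gluing_points: "Inl a \<in> pverts X" "Inl b \<in> pverts X"
  using ab by (auto simp: pverts_glue)

lemma gluing_arcs: "(Inl a, Inl b) \<in> parcs X" "(Inl b, Inl a) \<in> parcs X"
proof -
  show "(Inl a, Inl b) \<in> parcs X"
    using adj ab cd adjacent_glue_iff[of a b c d G H] by (simp add: adjacent_def)
  then show "(Inl b, Inl a) \<in> parcs X"
    using X.pair_sym_arcs by (auto simp: symmetric_def sym_def)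
qed

lemma gdist_gluing_points: "gdist X (Inl a) (Inl b) = 1" "gdist X (Inl b) (Inl a) = 1"
  using X.gdist_adjacent gluing_arcs by auto

lemma gdist_separated:
  assumes "x \<in> pverts G" "y \<in> pverts H - {c, d}"
  shows "gdist X (Inl x) (Inr y) =
    min (gdist X (Inl x) (Inl a) + gdist X (Inl a) (Inr y))
        (gdist X (Inl x) (Inl b) + gdist X (Inl b) (Inr y))"
\<comment> \<open>The side \<open>range Inl\<close> contains the gluing points; an arc leaving it
  comes from \<open>H\<close> and starts at an identified vertex.\<close>
proof (rule X.gdist_separator[where A = "range Inl"])
  show "u \<in> {Inl a, Inl b}"
    if "(u, v) \<in> parcs X" "u \<in> range Inl" "v \<notin> range Inl" for u v
    using that by (auto simp: parcs_glue identify_def split: if_splits)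
  show "Inl x \<in> pverts X" "Inl a \<in> pverts X" "Inl b \<in> pverts X"
    using assms ab by (auto simp: pverts_glue)
qed auto

text \<open>Adjacency of the gluing points enters here, supplying the hypotheses of
  \<open>qpow_twist\<close>.\<close>

lemma gdist_gluing_points_near:
  assumes "v \<in> pverts X"
  shows "gdist X v (Inl a) \<le> gdist X v (Inl b) + 1" "gdist X v (Inl b) \<le> gdist X v (Inl a) + 1"
  using X.gdist_triangle[OF assms, of "Inl b" "Inl a"] X.gdist_triangle[OF assms, of "Inl a" "Inl b"]
  by (simp_all add: gdist_gluing_points gluing_points)

text \<open>Since the gluing points are adjacent, collapsing one side of \<open>X\<close> onto them is a map to
  \<open>Y\<close> that does not increase distances.\<close>

lemma gdist_twist_le_Inl:
  assumes "x \<in> pverts G"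
  shows "gdist Y (Inl x) (Inl y) \<le> gdist X (Inl x) (Inl y)"
proof -
  interpret twist: glued_pair G a b H d c by (rule swap)
  define f :: "'a + 'b \<Rightarrow> 'a + 'b" where "f v = (case v of Inl x \<Rightarrow> Inl x | Inr _ \<Rightarrow> Inl a)" for v
  have "(f u, f v) \<in> (parcs Y)\<^sup>=" if "(u, v) \<in> parcs X" for u v
  proof -
    from that show ?thesis
    proof (cases rule: parcs_glueE)
      case left
      then show ?thesis by (force simp: f_def parcs_glue)
    next
      case right
      \<comment> \<open>An arc from \<open>H\<close> is contracted or sent to the arc between the
        gluing points, which \<open>Y\<close> contains in both directions.\<close>
      have "f (identify a b c d (Inr z)) \<in> {Inl a, Inl b}" for z by (simp add: f_def identify_def)
      then have "f u \<in> {Inl a, Inl b}" "f v \<in> {Inl a, Inl b}" using right by blast+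
      then show ?thesis using twist.gluing_arcs by auto
    qed
  qed
  then have "gdist Y (f (Inl x)) (f (Inl y)) \<le> gdist X (Inl x) (Inl y)"
    using assms ab X.pair_wf_digraph_axioms Y.pair_wf_digraph_axioms
    by (intro gdist_hom_le) (auto simp: f_def pverts_glue)
  then show ?thesis by (simp add: f_def)
qed

lemma gdist_twist_le_Inr:
  assumes "y \<in> pverts H" "z \<in> pverts H"
  shows "gdist Y (identify a b d c (Inr y)) (identify a b d c (Inr z)) \<le>
    gdist X (identify a b c d (Inr y)) (identify a b c d (Inr z))"
proof -
  interpret twist: glued_pair G a b H d c by (rule swap)
  \<comment> \<open>To be the identity on the copy of \<open>H\<close>, the map must exchange the
    gluing points: \<open>c\<close> is \<open>Inl a\<close> in \<open>X\<close> but
    \<open>Inl b\<close> in \<open>Y\<close>.\<close>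
  define f :: "'a + 'b \<Rightarrow> 'a + 'b"
    where "f v = (case v of Inl x \<Rightarrow> if x = a then Inl b else Inl a | Inr y \<Rightarrow> Inr y)" for v
  have f: "f (identify a b c d (Inr z)) = identify a b d c (Inr z)" for z
    using ab cd by (simp add: f_def identify_def)
  have "(f u, f v) \<in> (parcs Y)\<^sup>=" if "(u, v) \<in> parcs X" for u v
  proof -
    from that show ?thesis
    proof (cases rule: parcs_glueE)
      case left
      then have "f u \<in> {Inl a, Inl b}" "f v \<in> {Inl a, Inl b}" by (simp_all add: f_def)
      then show ?thesis using twist.gluing_arcs by auto
    next
      case right
      then show ?thesis by (force simp: f parcs_glue)
    qed
  qed
  moreover have "identify a b c d (Inr y) \<in> pverts X" "identify a b d c (Inr y) \<in> pverts Y"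
    using assms ab by (auto simp: pverts_glue identify_def)
  ultimately show ?thesis
    using X.pair_wf_digraph_axioms Y.pair_wf_digraph_axioms
    unfolding f[symmetric] by (intro gdist_hom_le) (auto simp: f)
qed

lemma gdist_twist_Inl:
  assumes "x \<in> pverts G"
  shows "gdist Y (Inl x) (Inl y) = gdist X (Inl x) (Inl y)"
  using gdist_twist_le_Inl[OF assms] glued_pair.gdist_twist_le_Inl[OF swap assms] by (rule antisym)

lemma gdist_twist_Inr:
  assumes "y \<in> pverts H" "z \<in> pverts H"
  shows "gdist Y (identify a b d c (Inr y)) (identify a b d c (Inr z)) =
    gdist X (identify a b c d (Inr y)) (identify a b c d (Inr z))"
  using gdist_twist_le_Inr[OF assms] glued_pair.gdist_twist_le_Inr[OF swap assms] by (rule antisym)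

text \<open>Both distances from \<open>x\<close> to \<open>y\<close> are minima over the two gluing
  points. The twist keeps the distances from \<open>x\<close> to these points and exchanges those
  from them to \<open>y\<close>, so \<open>qpow_twist\<close> applies.\<close>

lemma Zmat_twist:
  assumes "x \<in> pverts G" "y \<in> pverts H - {c, d}"
  shows "(1 - qvar) * (Zmat X (Inl x) (Inr y) - Zmat Y (Inl x) (Inr y)) =
    (Zmat X (Inl x) (Inl a) - Zmat X (Inl x) (Inl b)) *
    (Zmat X (Inl a) (Inr y) - Zmat X (Inl b) (Inr y))"
proof -
  interpret twist: glued_pair G a b H d c by (rule swap)
  have v: "Inl x \<in> pverts X" "Inr y \<in> pverts X" using assms ab by (auto simp: pverts_glue)
  have "gdist Y (Inl a) (Inr y) = gdist X (Inl b) (Inr y)"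
    "gdist Y (Inl b) (Inr y) = gdist X (Inl a) (Inr y)"
    using gdist_twist_Inr[of d y] gdist_twist_Inr[of c y] assms cd by (auto simp: identify_def)
  then have "gdist Y (Inl x) (Inr y) =
      min (gdist X (Inl x) (Inl a) + gdist X (Inl b) (Inr y))
          (gdist X (Inl x) (Inl b) + gdist X (Inl a) (Inr y))"
    using twist.gdist_separated[of x y] assms by (simp add: gdist_twist_Inl)
  then show ?thesis
    unfolding Zmat_def gdist_separated[OF assms]
    using qpow_twist gdist_gluing_points_near[OF v(1)] gdist_gluing_points_near[OF v(2)]
    by (simp add: X.gdist_sym[OF v(2)] gluing_points)
qed

lemma magnitude_twist: "magnitude X = magnitude Y"
proof -
  let ?A = "Zmat X" and ?B = "Zmat Y" and ?P = "Inl ` (pverts G - {a, b})"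
    and ?W = "Inr ` (pverts H - {c, d})"
  obtain w where w: "\<And>x. x \<in> pverts X \<Longrightarrow> (\<Sum>y\<in>pverts X. ?A x y * w y) = 1"
    using X.weighting_exists by blast
  have V: "pverts X = ?P \<union> ?W \<union> {Inl a, Inl b}"
    using ab by (auto simp: pverts_glue)
  have P: "\<exists>x'. x = Inl x' \<and> x' \<in> pverts G" if "x \<in> ?P \<union> {Inl a, Inl b}" for x
    using that ab by auto
  have W: "\<exists>y'. y = Inr y' \<and> y' \<in> pverts H - {c, d}" if "y \<in> ?W" for y
    using that by auto
  have symA: "?A x y = ?A y x" and symB: "?B x y = ?B y x"
    if "x \<in> pverts X" "y \<in> pverts X" for x y
    using that X.gdist_sym Y.gdist_sym pverts_Y by (simp_all add: Zmat_def)
  have PP: "?B x y = ?A x y" if "x \<in> ?P \<union> {Inl a, Inl b}" "y \<in> ?P \<union> {Inl a, Inl b}" for x y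
    using P[OF that(1)] P[OF that(2)] by (auto simp: Zmat_def gdist_twist_Inl)
  have WW: "?B x y = ?A x y" if xy: "x \<in> ?W" "y \<in> ?W" for x y
  proof -
    obtain x' y' where "x = Inr x'" "x' \<in> pverts H - {c, d}" "y = Inr y'" "y' \<in> pverts H - {c, d}"
      using W[OF xy(1)] W[OF xy(2)] by blast
    then show ?thesis using gdist_twist_Inr[of x' y'] by (simp add: Zmat_def identify_def)
  qed
  have W_pm: "?B x (Inl a) = ?A x (Inl b) \<and> ?B x (Inl b) = ?A x (Inl a)" if x: "x \<in> ?W" for x
  proof -
    obtain x' where "x = Inr x'" "x' \<in> pverts H - {c, d}" using W[OF x] by blast
    then show ?thesis
      using gdist_twist_Inr[of x' c] gdist_twist_Inr[of x' d] cd by (simp add: Zmat_def identify_def)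
  qed
  have PW: "(1 - qvar) * (?A x y - ?B x y) =
      (?A x (Inl a) - ?A x (Inl b)) * (?A (Inl a) y - ?A (Inl b) y)"
    if "x \<in> ?P \<union> {Inl a, Inl b}" "y \<in> ?W" for x y
    using P[OF that(1)] W[OF that(2)] Zmat_twist by blast
  have WP: "(1 - qvar) * (?A x y - ?B x y) =
      (?A x (Inl a) - ?A x (Inl b)) * (?A (Inl a) y - ?A (Inl b) y)"
    \<comment> \<open>The rank one formula is symmetric under exchanging \<open>x\<close> and
      \<open>y\<close>, so this block follows from \<open>PW\<close>.\<close>
    if "x \<in> ?W" "y \<in> ?P" for x y
  proof -
    have "x \<in> pverts X" "y \<in> pverts X" using that V by auto
    then show ?thesis
      using PW[of y x] that gluing_points
      by (simp add: symA[of x] symB[of x] symA[of _ y] mult.commute)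
  qed
  have "\<exists>w'. (\<forall>x\<in>pverts X. (\<Sum>y\<in>pverts X. ?B x y * w' y) = 1) \<and> sum w' (pverts X) = sum w (pverts X)"
  \<comment> \<open>The constant is \<open>r = 1 - qvar\<close>, since the gluing points are at
    distance 1 and the entry there is \<open>qvar = 1 - r\<close>.\<close>
  proof (rule twisted_weighting[OF _ _ _ _ _ _ _ _ V one_minus_qvar_nonzero _ _ _ _ PP WW _ _ PW WP w])
    show "?A (Inl a) (Inl a) = 1" "?A (Inl b) (Inl b) = 1"
      "?A (Inl a) (Inl b) = 1 - (1 - qvar)" "?A (Inl b) (Inl a) = 1 - (1 - qvar)"
      by (simp_all add: Zmat_def X.gdist_self gluing_points gdist_gluing_points)
    show "?B x (Inl a) = ?A x (Inl b)" "?B x (Inl b) = ?A x (Inl a)" if "x \<in> ?W" for x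
      using W_pm[OF that] by simp_all
  qed (use ab G.pair_finite_verts H.pair_finite_verts in auto)
  then obtain w' where w': "\<And>x. x \<in> pverts X \<Longrightarrow> (\<Sum>y\<in>pverts X. ?B x y * w' y) = 1"
    "sum w' (pverts X) = sum w (pverts X)" by blast
  have "magnitude X = sum w (pverts X)" using w by (rule X.magnitude_eq_weighting)
  moreover have "magnitude Y = sum w' (pverts Y)"
    using w'(1) by (intro Y.magnitude_eq_weighting) (simp add: pverts_Y)
  ultimately show ?thesis using w'(2) by (simp add: pverts_Y)
qed

end

theorem theorem5p2:
  fixes G :: "'a pair_pre_digraph" and gp gm :: 'a
    and H :: "'b pair_pre_digraph" and hp hm :: 'b
    and X Y :: "('a + 'b) pair_pre_digraph"
  assumes "pair_graph G" "gp \<in> pverts G" "gm \<in> pverts G" "gp \<noteq> gm"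
    and "pair_graph H" "hp \<in> pverts H" "hm \<in> pverts H" "hp \<noteq> hm"
    and X: "X = glue G gp gm H hp hm"
    and Y: "Y = glue G gp gm H hm hp"
  shows "(adjacent X (Inl gp) (Inl gm) \<longleftrightarrow> adjacent G gp gm \<or> adjacent H hp hm) \<and>
         (adjacent X (Inl gp) (Inl gm) \<longleftrightarrow> adjacent Y (Inl gp) (Inl gm)) \<and>
         (adjacent X (Inl gp) (Inl gm) \<longrightarrow> magnitude X = magnitude Y)"
proof -
  have "adjacent H hm hp \<longleftrightarrow> adjacent H hp hm"
    using \<open>pair_graph H\<close> pair_sym_digraph.pair_sym_arcs[of H]
    by (auto simp: adjacent_def pair_graph_def pair_pseudo_graph_def symmetric_def sym_def)
  then have adj: "adjacent X (Inl gp) (Inl gm) \<longleftrightarrow> adjacent G gp gm \<or> adjacent H hp hm"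
    "adjacent Y (Inl gp) (Inl gm) \<longleftrightarrow> adjacent G gp gm \<or> adjacent H hp hm"
    using assms adjacent_glue_iff[of gp gm hp hm G H] adjacent_glue_iff[of gp gm hm hp G H] by auto
  moreover have "magnitude X = magnitude Y" if "adjacent X (Inl gp) (Inl gm)"
  proof -
    have "glued_pair G gp gm H hp hm"
      using assms that adj by (intro glued_pair.intro glued_pair_axioms.intro) auto
    then show ?thesis unfolding X Y by (rule glued_pair.magnitude_twist)
  qed
  ultimately show ?thesis by blast
qed

end
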